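(* Let $q>1$, $\mathcal{Q}=\{q^n:n\in\mathbb{N}_0\}$, $a\in\mathcal{Q}$, $r\in\mathbb{N}$, and let $f_0,f_1,\ldots,f_r:[a,+\infty[\rightarrow\mathbb{R}$. If $$\lim_{T\to+\infty}\inf_{T'\ge T}\int_a^{T'}\left(\sum_{i=0}^{r}f_i(t)\,D_q^i[\eta\circ\sigma^{r-i}](t)\right)d_qt=0$$ for all $\eta:[a,+\infty[\rightarrow\mathbb{R}$ such that $\eta(a)=0$, $D_q[\eta](a)=0$, ..., $D_q^{r-1}[\eta](a)=0$, then $$\lim_{T\to+\infty}\inf_{T'\ge T}\left\{f_r(T')\cdot D_q^{r-1}[\eta](T')\right\}=0$$ for all such $\eta$.
   Context: Here $q>1$ is a fixed real, $\mathcal{Q}=\{q^n:n\in\mathbb{N}_0\}$, $\mathbb{N}=\{1,2,\ldots\}$, and intervals are $q$-intervals: $[a,+\infty[=\{t\in\mathcal{Q}:t\ge a\}$. The map $\sigma$ is $\sigma(t)=qt$, with $\sigma^0=\mathrm{id}$ and $\sigma^k(t)=q^kt$. The Jackson $q$-difference operator is $D_q[f](t)=\frac{f(qt)-f(t)}{(q-1)t}$, with $D_q^0[f]=f$ and $D_q^i[f]=D_q[D_q^{i-1}[f]]$. For $b=aq^n$ ($n\in\mathbb{N}_0$), $\int_a^bf(t)\,d_qt=a(q-1)\sum_{k=0}^{n-1}q^kf(aq^k)$. In $\lim_{T\to+\infty}\inf_{T'\ge T}$, $T$ and $T'$ range over elements of $\mathcal{Q}$ with $T'\ge T>a$, and infima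 and limits are taken in $\overline{\mathbb{R}}=\mathbb{R}\cup\{\pm\infty\}$. *)

theory Defs
  imports "HOL-Library.Extended_Real"
begin

text \<open>
  Functions on a \<open>q\<close>-interval \<open>[a, +\<infinity>[\<close> are represented by total functions
  on the reals: all operators below, evaluated at points \<open>a * q ^ n\<close>, only
  use the values at such points, so the values elsewhere are irrelevant.
\<close>

definition q_set :: "real \<Rightarrow> real set" where
  "q_set q = {q ^ n | n :: nat. True}"

definition q_shift :: "real \<Rightarrow> real \<Rightarrow> real" where
  "q_shift q t = q * t"

definition q_diff :: "real \<Rightarrow> (real \<Rightarrow> real) \<Rightarrow> real \<Rightarrow> real" where
  "q_diff q f t = (f (q_shift q t) - f t) / ((q - 1) * t)"

text \<open>Only meaningful for \<open>b = a * q ^ n\<close>; the exponent is then unique when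
  \<open>q > 1\<close> and \<open>a > 0\<close>.\<close>

definition q_integral :: "real \<Rightarrow> real \<Rightarrow> real \<Rightarrow> (real \<Rightarrow> real) \<Rightarrow> real" where
  "q_integral q a b f =
     (let n = (THE n :: nat. b = a * q ^ n)
      in a * (q - 1) * (\<Sum>k<n. q ^ k * f (a * q ^ k)))"

lemma q_integral_power:
  assumes "q > 1" and "a > 0"
  shows "q_integral q a (a * q ^ n) f = a * (q - 1) * (\<Sum>k<n. q ^ k * f (a * q ^ k))"
proof -
  have "(THE m :: nat. a * q ^ n = a * q ^ m) = n"
    using assms by (intro the_equality) (auto simp: power_inject_exp)
  then show ?thesis
    by (simp add: q_integral_def)
qed

definition q_tail_inf :: "real \<Rightarrow> (real \<Rightarrow> real) \<Rightarrow> real \<Rightarrow> ereal" where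
  "q_tail_inf q F T = (INF T' \<in> {T' \<in> q_set q. T' \<ge> T}. ereal (F T'))"

text \<open>The filter of \<open>T \<rightarrow> +\<infinity>\<close> with \<open>T\<close> ranging over the elements of
  \<open>q_set q\<close> greater than \<open>a\<close>.\<close>

definition q_at_top :: "real \<Rightarrow> real \<Rightarrow> real filter" where
  "q_at_top q a = inf at_top (principal {T \<in> q_set q. T > a})"

lemma q_at_top_neq_bot:
  assumes "q > 1"
  shows "q_at_top q a \<noteq> bot"
proof
  assume "q_at_top q a = bot"
  then have "eventually (\<lambda>T. T \<notin> {T \<in> q_set q. T > a}) at_top"
    by (simp add: q_at_top_def trivial_limit_def eventually_inf_principal)
  then obtain N where N: "\<And>T. T \<ge> N \<Longrightarrow> \<not> (T \<in> q_set q \<and> T > a)"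
    by (auto simp: eventually_at_top_linorder)
  obtain n where "max N a < q ^ n"
    using real_arch_pow[OF assms] by blast
  then show False
    using N[of "q ^ n"] by (auto simp: q_set_def)
qed

end

theory Submission
  imports Defs
begin

text \<open>
  The hypothesis is much stronger than it looks: it forces \<open>f\<^sub>r\<close> to vanish at all
  sufficiently large points, after which the conclusion is trivial.

  Write \<open>t\<^sub>k = a q\<^sup>k\<close> and let \<open>L\<^sub>k \<eta>\<close> be the integrand at \<open>t\<^sub>k\<close>. Admissible functions are closed
  under negation, so the hypothesis for \<open>\<eta>\<close> and \<open>-\<eta>\<close> bounds both the lower and the upper limit,
  and the integrals converge to \<open>0\<close> in the usual sense (\<open>tendsto_0_of_q_tail_inf\<close>). Consecutive
  integrals differ by \<open>(q - 1) t\<^sub>k L\<^sub>k \<eta>\<close>, which therefore tends to \<open>0\<close> for every admissible \<open>\<eta>\<close>.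

  Now \<open>L\<^sub>k \<eta>\<close> involves only the values of \<open>\<eta>\<close> at \<open>t\<^sub>k, \<dots>, t\<^bsub>k+r\<^esub>\<close>, and the value at \<open>t\<^sub>k\<close> enters
  only through \<open>D\<^sub>q\<^sup>r[\<eta>]\<close>: for \<open>i < r\<close> the shift \<open>\<sigma>\<^bsup>r-i\<^esup>\<close> moves the stencil past \<open>t\<^sub>k\<close>. If
  \<open>f\<^sub>r(t\<^sub>k) \<noteq> 0\<close> for infinitely many \<open>k\<close>, choose infinitely many of them at mutual distance greater
  than \<open>r\<close>, and let \<open>\<eta>\<close> be supported on the chosen points. For these \<open>k\<close> the number \<open>L\<^sub>k \<eta>\<close> is then a
  nonzero multiple of \<open>f\<^sub>r(t\<^sub>k) \<eta>(t\<^sub>k)\<close> (\<open>integrand_of_isolated_value\<close>), and \<open>\<eta>(t\<^sub>k)\<close> can be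
  scaled so that \<open>(q - 1) t\<^sub>k L\<^sub>k \<eta> = 1\<close> infinitely often, a contradiction.
\<close>

lemma q_at_top_eq_filtermap:
  assumes "q > 1" and "a \<in> q_set q"
  shows "q_at_top q a = filtermap (\<lambda>n. a * q ^ n) sequentially"
proof (rule filter_eqI)
  fix P
  obtain l where l: "a = q ^ l" using assms(2) by (auto simp: q_set_def)
  have a0: "a > 0" using l assms(1) by simp
  have "filterlim (\<lambda>n. q ^ n) at_top sequentially"
    using assms(1) by (intro filterlim_at_infinity_imp_filterlim_at_top
        filterlim_realpow_sequentially_gt1) auto
  then have top: "filterlim (\<lambda>n. a * q ^ n) at_top sequentially"
    by (rule filterlim_tendsto_pos_mult_at_top[OF tendsto_const a0])
  have iff: "eventually P (q_at_top q a) \<longleftrightarrow> (\<exists>N. \<forall>T\<ge>N. T \<in> q_set q \<and> T > a \<longrightarrow> P T)"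
    by (auto simp: q_at_top_def eventually_inf_principal eventually_at_top_linorder)
  show "eventually P (q_at_top q a) =
      eventually P (filtermap (\<lambda>n. a * q ^ n) sequentially)"
    unfolding iff eventually_filtermap
  proof
    assume "\<exists>N. \<forall>T\<ge>N. T \<in> q_set q \<and> T > a \<longrightarrow> P T"
    then obtain N where N: "\<And>T. T \<ge> N \<Longrightarrow> T \<in> q_set q \<Longrightarrow> T > a \<Longrightarrow> P T" by blast
    have mem: "a * q ^ n \<in> q_set q" for n
      by (auto simp: q_set_def l power_add[symmetric])
    have "eventually (\<lambda>n. a * q ^ n \<ge> N) sequentially"
      using top by (simp add: filterlim_at_top)
    moreover have "eventually (\<lambda>n. a * q ^ n > a) sequentially"
      using top by (simp add: filterlim_at_top_dense)
    ultimately show "\<forall>\<^sub>F n in sequentially. P (a * q ^ n)"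
      by eventually_elim (use N mem in blast)
  next
    assume "\<forall>\<^sub>F n in sequentially. P (a * q ^ n)"
    then obtain N where N: "\<And>n. n \<ge> N \<Longrightarrow> P (a * q ^ n)"
      by (auto simp: eventually_sequentially)
    have "P T" if T: "T \<ge> a * q ^ N" "T \<in> q_set q" for T
    proof -
      obtain m where m: "T = q ^ m" using T(2) by (auto simp: q_set_def)
      have "q ^ (l + N) \<le> q ^ m" using T(1) by (simp add: m l power_add)
      then have le: "l + N \<le> m" using assms(1) by simp
      then have "T = a * q ^ (m - l)"
        by (simp add: m l power_add[symmetric])
      then show ?thesis using N[of "m - l"] le by simp
    qed
    then show "\<exists>N. \<forall>T\<ge>N. T \<in> q_set q \<and> T > a \<longrightarrow> P T" by blast
  qed
qed

text \<open>
  \<open>q_tail_inf q F T\<close> tends to the lower limit of \<open>F\<close>; for \<open>- F\<close> it tends to the negative of the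
  upper limit. If both are \<open>0\<close>, then \<open>F\<close> converges.
\<close>

lemma tendsto_0_of_q_tail_inf:
  assumes "(q_tail_inf q F \<longlongrightarrow> 0) (q_at_top q a)"
    and "(q_tail_inf q (\<lambda>T. - F T) \<longlongrightarrow> 0) (q_at_top q a)"
  shows "(F \<longlongrightarrow> 0) (q_at_top q a)"
proof (rule tendstoI)
  fix e :: real assume e: "e > 0"
  have lower: "eventually (\<lambda>T. G T > - e) (q_at_top q a)"
    if G: "(q_tail_inf q G \<longlongrightarrow> 0) (q_at_top q a)" for G
  proof -
    have "eventually (\<lambda>T. q_tail_inf q G T > ereal (- e)) (q_at_top q a)"
      using e by (intro order_tendstoD(1)[OF G]) simp
    moreover have "eventually (\<lambda>T. T \<in> q_set q) (q_at_top q a)"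
      by (simp add: q_at_top_def eventually_inf_principal)
    ultimately show ?thesis
    proof eventually_elim
      case (elim T)
      have "q_tail_inf q G T \<le> ereal (G T)"
        unfolding q_tail_inf_def using elim(2) by (intro INF_lower) simp
      with elim(1) have "ereal (- e) < ereal (G T)" by (rule less_le_trans)
      then show ?case by simp
    qed
  qed
  show "eventually (\<lambda>T. dist (F T) 0 < e) (q_at_top q a)"
    using lower[OF assms(1)] lower[OF assms(2)]
    by eventually_elim (simp add: dist_real_def abs_less_iff)
qed

lemma q_tail_inf_tendsto_0_of_eventually_0:
  assumes "eventually (\<lambda>T. F T = 0) (q_at_top q a)"
  shows "(q_tail_inf q F \<longlongrightarrow> 0) (q_at_top q a)"
proof (rule tendsto_eventually)
  obtain N where N: "\<And>T. T \<ge> N \<Longrightarrow> T \<in> q_set q \<Longrightarrow> T > a \<Longrightarrow> F T = 0"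
    using assms by (auto simp: q_at_top_def eventually_inf_principal eventually_at_top_linorder)
  have "q_tail_inf q F T = 0" if "T \<ge> N" "T \<in> q_set q" "T > a" for T
  proof -
    have "q_tail_inf q F T = (INF T' \<in> {T' \<in> q_set q. T' \<ge> T}. 0)"
      unfolding q_tail_inf_def
      by (intro INF_cong refl) (use N that in auto)
    also have "\<dots> = 0" using that by (intro cINF_const) auto
    finally show ?thesis .
  qed
  then show "eventually (\<lambda>T. q_tail_inf q F T = 0) (q_at_top q a)"
    by (auto simp: q_at_top_def eventually_inf_principal eventually_at_top_linorder)
qed

lemma q_shift_funpow: "(q_shift q ^^ m) t = q ^ m * t"
  by (induction m) (auto simp: q_shift_def)

lemma q_diff_funpow_Suc:
  "(q_diff q ^^ Suc i) \<eta> t =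
    ((q_diff q ^^ i) \<eta> (q * t) - (q_diff q ^^ i) \<eta> t) / ((q - 1) * t)"
  by (simp add: q_diff_def[of q "(q_diff q ^^ i) \<eta>"] q_shift_def)

lemma q_diff_funpow_uminus:
  "(q_diff q ^^ i) (\<lambda>x. - \<eta> x) = (\<lambda>x. - (q_diff q ^^ i) \<eta> x)"
proof (induction i)
  case (Suc i)
  have "q_diff q (\<lambda>x. - g x) = (\<lambda>x. - q_diff q g x)" for g
    by (auto simp: fun_eq_iff q_diff_def minus_divide_left)
  then show ?case using Suc by simp
qed simp

lemma q_diff_funpow_eq_0:
  assumes "\<forall>j\<le>i. \<eta> (q ^ j * t) = 0"
  shows "(q_diff q ^^ i) \<eta> t = 0"
  using assms
proof (induction i arbitrary: t)
  case (Suc i)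
  have "\<eta> (q ^ j * (q * t)) = 0" if "j \<le> i" for j
    using Suc.prems[rule_format, of "Suc j"] that by (simp add: mult_ac)
  then have "(q_diff q ^^ i) \<eta> (q * t) = 0"
    by (intro Suc.IH) simp
  moreover have "(q_diff q ^^ i) \<eta> t = 0"
    using Suc.prems by (intro Suc.IH) simp
  ultimately show ?case by (simp add: q_diff_funpow_Suc del: funpow.simps)
qed simp

lemma q_diff_funpow_of_isolated_value:
  assumes "\<forall>j\<in>{1..i}. \<eta> (q ^ j * t) = 0"
  shows "(q_diff q ^^ i) \<eta> t = (- 1 / ((q - 1) * t)) ^ i * \<eta> t"
  using assms
proof (induction i)
  case (Suc i)
  have "\<eta> (q ^ j * (q * t)) = 0" if "j \<le> i" for j
    using Suc.prems[rule_format, of "Suc j"] that by (simp add: mult_ac)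
  then have "(q_diff q ^^ i) \<eta> (q * t) = 0"
    by (intro q_diff_funpow_eq_0) simp
  moreover have "(q_diff q ^^ i) \<eta> t = (- 1 / ((q - 1) * t)) ^ i * \<eta> t"
    using Suc.prems by (intro Suc.IH) simp
  ultimately show ?case by (simp add: q_diff_funpow_Suc del: funpow.simps)
qed simp

text \<open>
  For \<open>i < r\<close> the term \<open>D\<^sub>q\<^sup>i[\<eta> \<circ> \<sigma>\<^bsup>r-i\<^esup>](t)\<close> only sees \<open>\<eta>\<close> at \<open>q\<^sup>j t\<close> with \<open>r - i \<le> j \<le> r\<close>, where
  \<open>\<eta>\<close> vanishes; only the term with \<open>i = r\<close> reaches back to \<open>t\<close> itself.
\<close>

lemma integrand_of_isolated_value:
  assumes "\<forall>j\<in>{1..r}. \<eta> (q ^ j * t) = 0"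
  shows "(\<Sum>i\<le>r. f i t * (q_diff q ^^ i) (\<eta> \<circ> (q_shift q ^^ (r - i))) t) =
    f r t * ((- 1 / ((q - 1) * t)) ^ r * \<eta> t)"
proof -
  have "(q_diff q ^^ i) (\<eta> \<circ> (q_shift q ^^ (r - i))) t = 0" if "i < r" for i
  proof (intro q_diff_funpow_eq_0 allI impI)
    fix j assume "j \<le> i"
    then have "r - i + j \<in> {1..r}" using that by auto
    then have "\<eta> (q ^ (r - i + j) * t) = 0" using assms by blast
    then show "(\<eta> \<circ> (q_shift q ^^ (r - i))) (q ^ j * t) = 0"
      unfolding o_def q_shift_funpow power_add by (simp add: mult_ac)
  qed
  then have "(\<Sum>i\<le>r. f i t * (q_diff q ^^ i) (\<eta> \<circ> (q_shift q ^^ (r - i))) t) =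
      f r t * (q_diff q ^^ r) \<eta> t"
    by (simp add: lessThan_Suc_atMost[symmetric] o_def)
  then show ?thesis
    using q_diff_funpow_of_isolated_value[OF assms] by simp
qed

text \<open>
  Convergence for \<^emph>\<open>every\<close> admissible \<open>\<eta>\<close> leaves no room for a tail: the values of \<open>\<eta>\<close> may grow
  as fast as needed to compensate for any decay of \<open>f\<^sub>r\<close>, so a single \<open>\<eta>\<close> with sparse support detects
  infinitely many points where \<open>f\<^sub>r\<close> does not vanish.
\<close>

lemma leading_coefficient_eventually_0:
  fixes q a :: real and r :: nat and f :: "nat \<Rightarrow> real \<Rightarrow> real"
  assumes q: "q > 1" and a: "a \<in> q_set q"
    and lim: "\<And>\<eta> :: real \<Rightarrow> real. (\<forall>i<r. (q_diff q ^^ i) \<eta> a = 0) \<Longrightarrow>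
      ((\<lambda>T'. q_integral q a T'
            (\<lambda>t. \<Sum>i\<le>r. f i t * (q_diff q ^^ i) (\<eta> \<circ> (q_shift q ^^ (r - i))) t))
       \<longlongrightarrow> 0) (q_at_top q a)"
  shows "eventually (\<lambda>T. f r T = 0) (q_at_top q a)"
proof (rule ccontr)
  assume "\<not> ?thesis"
  have a0: "a > 0" using a q by (auto simp: q_set_def)
  define B where "B = {n. f r (a * q ^ n) \<noteq> 0}"
  from \<open>\<not> ?thesis\<close> have "infinite B"
    by (simp add: q_at_top_eq_filtermap[OF q a] eventually_filtermap B_def
        frequently_cofinite[symmetric] cofinite_eq_sequentially frequently_def)
  \<comment> \<open>One residue class modulo \<open>r + 1\<close> has infinitely many elements of \<open>B\<close>, and distinct elements
    of a residue class are more than \<open>r\<close> apart.\<close>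
  moreover have "finite ((\<lambda>n. n mod Suc r) ` B)"
    by (rule finite_subset[of _ "{..r}"]) (auto simp: less_Suc_eq_le[symmetric])
  ultimately obtain c where inf: "infinite {n \<in> B. n mod Suc r = c}"
    using pigeonhole_infinite[of B "\<lambda>n. n mod Suc r"] by blast
  \<comment> \<open>The points \<open>a q\<^sup>n\<close> with \<open>n < r\<close> are left out to satisfy the initial conditions.\<close>
  define C where "C = {n \<in> B. n mod Suc r = c} - {..<r}"
  have "infinite C" unfolding C_def using inf by (intro Diff_infinite_finite) auto
  define X where "X = (\<lambda>n. a * q ^ n) ` C"
  have X_iff: "a * q ^ n \<in> X \<longleftrightarrow> n \<in> C" for n
    using a0 q by (auto simp: X_def power_inject_exp)
  \<comment> \<open>The value that makes \<open>(q - 1) t\<close> times the integrand at \<open>t \<in> X\<close> equal to \<open>1\<close>.\<close>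
  define \<eta> where
    "\<eta> t = (if t \<in> X then (- ((q - 1) * t)) ^ r / ((q - 1) * t * f r t) else 0)" for t
  define L where
    "L t = (\<Sum>i\<le>r. f i t * (q_diff q ^^ i) (\<eta> \<circ> (q_shift q ^^ (r - i))) t)" for t
  have "(q_diff q ^^ i) \<eta> a = 0" if "i < r" for i
  proof (intro q_diff_funpow_eq_0 allI impI)
    fix j assume "j \<le> i"
    then have "j \<notin> C" using that by (simp add: C_def)
    then show "\<eta> (q ^ j * a) = 0"
      using X_iff[of j] by (simp add: \<eta>_def mult.commute)
  qed
  then have "((\<lambda>T. q_integral q a T L) \<longlongrightarrow> 0) (q_at_top q a)"
    unfolding L_def by (intro lim) blast
  then have "(\<lambda>n. q_integral q a (a * q ^ n) L) \<longlonglongrightarrow> 0"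
    by (simp add: q_at_top_eq_filtermap[OF q a] filterlim_filtermap)
  then have I: "(\<lambda>n. a * (q - 1) * (\<Sum>k<n. q ^ k * L (a * q ^ k))) \<longlonglongrightarrow> 0"
    by (simp only: q_integral_power[OF q a0])
  have "(\<lambda>n. a * (q - 1) * (\<Sum>k<Suc n. q ^ k * L (a * q ^ k))
      - a * (q - 1) * (\<Sum>k<n. q ^ k * L (a * q ^ k))) \<longlonglongrightarrow> 0 - 0"
    by (rule tendsto_diff[OF LIMSEQ_Suc[OF I] I])
  then have "(\<lambda>n. (q - 1) * (a * q ^ n) * L (a * q ^ n)) \<longlonglongrightarrow> 0"
    by (simp add: algebra_simps)
  then have "eventually (\<lambda>n. (q - 1) * (a * q ^ n) * L (a * q ^ n) < 1) sequentially"
    by (rule order_tendstoD(2)) simp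
  then obtain N where N: "\<And>n. n \<ge> N \<Longrightarrow> (q - 1) * (a * q ^ n) * L (a * q ^ n) < 1"
    by (auto simp: eventually_sequentially)
  obtain n where n: "n \<in> C" "n \<ge> N"
    using \<open>infinite C\<close> by (meson infinite_nat_iff_unbounded_le)
  define t where "t = a * q ^ n"
  have t0: "t > 0" using a0 q by (simp add: t_def)
  have ft: "f r t \<noteq> 0" using n(1) by (simp add: C_def B_def t_def)
  have "\<eta> (q ^ j * t) = 0" if j: "j \<in> {1..r}" for j
  proof -
    have "n + j \<notin> C"
    proof
      assume "n + j \<in> C"
      then have "(n + j) mod Suc r = n mod Suc r" using n(1) by (simp add: C_def)
      then have "Suc r dvd (n + j) - n" by (subst (asm) mod_eq_dvd_iff_nat) auto
      then show False using j by (auto dest: dvd_imp_le)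
    qed
    then show ?thesis
      using X_iff[of "n + j"] by (simp add: \<eta>_def t_def power_add mult_ac)
  qed
  then have "L t = f r t * ((- 1 / ((q - 1) * t)) ^ r * \<eta> t)"
    unfolding L_def by (intro integrand_of_isolated_value) blast
  moreover have "\<eta> t = (- ((q - 1) * t)) ^ r / ((q - 1) * t * f r t)"
    using n(1) X_iff[of n] by (simp add: \<eta>_def t_def)
  ultimately have "(q - 1) * t * L t =
      ((- 1 / ((q - 1) * t)) ^ r * (- ((q - 1) * t)) ^ r) *
      (((q - 1) * t * f r t) / ((q - 1) * t * f r t))"
    by simp
  also have "(- 1 / ((q - 1) * t)) ^ r * (- ((q - 1) * t)) ^ r = 1"
    using t0 q by (simp add: power_mult_distrib[symmetric])
  also have "((q - 1) * t * f r t) / ((q - 1) * t * f r t) = 1"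
    using t0 q ft by simp
  finally have "(q - 1) * t * L t = 1" by simp
  then show False using N[OF n(2)] by (simp add: t_def)
qed

theorem lemma8:
  fixes q a :: real and r :: nat and f :: "nat \<Rightarrow> real \<Rightarrow> real"
  assumes "q > 1" and "a \<in> q_set q" and "r \<ge> 1"
    and "\<forall>\<eta> :: real \<Rightarrow> real. (\<forall>i<r. (q_diff q ^^ i) \<eta> a = 0) \<longrightarrow>
      (q_tail_inf q
         (\<lambda>T'. q_integral q a T'
            (\<lambda>t. \<Sum>i\<le>r. f i t * (q_diff q ^^ i) (\<eta> \<circ> (q_shift q ^^ (r - i))) t))
       \<longlongrightarrow> 0) (q_at_top q a)"
  shows "\<forall>\<eta> :: real \<Rightarrow> real. (\<forall>i<r. (q_diff q ^^ i) \<eta> a = 0) \<longrightarrow>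
      (q_tail_inf q (\<lambda>T'. f r T' * (q_diff q ^^ (r - 1)) \<eta> T') \<longlongrightarrow> 0) (q_at_top q a)"
proof -
  define I where "I \<eta> T = q_integral q a T
      (\<lambda>t. \<Sum>i\<le>r. f i t * (q_diff q ^^ i) (\<eta> \<circ> (q_shift q ^^ (r - i))) t)" for \<eta> T
  have hyp: "(q_tail_inf q (I \<eta>) \<longlongrightarrow> 0) (q_at_top q a)"
    if "\<forall>i<r. (q_diff q ^^ i) \<eta> a = 0" for \<eta>
    using assms(4) that unfolding I_def by blast
  have neg: "I (\<lambda>x. - \<eta> x) T = - I \<eta> T" for \<eta> T
  proof -
    have "(q_diff q ^^ i) ((\<lambda>x. - \<eta> x) \<circ> g) t = - (q_diff q ^^ i) (\<eta> \<circ> g) t" for i g t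
      using q_diff_funpow_uminus[of i q "\<eta> \<circ> g"] by (simp add: o_def)
    then show ?thesis
      by (simp add: I_def q_integral_def Let_def sum_negf)
  qed
  have "(I \<eta> \<longlongrightarrow> 0) (q_at_top q a)" if \<eta>: "\<forall>i<r. (q_diff q ^^ i) \<eta> a = 0" for \<eta>
  proof (rule tendsto_0_of_q_tail_inf[OF hyp[OF \<eta>]])
    have "\<forall>i<r. (q_diff q ^^ i) (\<lambda>x. - \<eta> x) a = 0"
      using \<eta> by (simp add: q_diff_funpow_uminus)
    then show "(q_tail_inf q (\<lambda>T. - I \<eta> T) \<longlongrightarrow> 0) (q_at_top q a)"
      using hyp[of "\<lambda>x. - \<eta> x"] by (simp add: neg[abs_def])
  qed
  then have "eventually (\<lambda>T. f r T = 0) (q_at_top q a)"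
    unfolding I_def by (intro leading_coefficient_eventually_0[OF assms(1,2)]) blast
  then have "eventually (\<lambda>T. f r T * (q_diff q ^^ (r - 1)) \<eta> T = 0) (q_at_top q a)" for \<eta>
    by eventually_elim simp
  then show ?thesis by (blast intro: q_tail_inf_tendsto_0_of_eventually_0)
qed

end
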